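(* Let $X$ be an implicative-ortholattice. The following are equivalent: (a) $X$ is an implicative-orthomodular lattice; (b) for all $x,y\in X$, $x\,\mathcal{C}\,y$ implies $y\,\mathcal{C}\,x$.
   Context: A BE algebra is an algebra $(X,\to,1)$ such that for all $x,y,z\in X$: $x\to x=1$; $x\to 1=1$; $1\to x=x$; $x\to(y\to z)=y\to(x\to z)$. It carries the relation $x\le y$ iff $x\to y=1$. It is bounded if there is $0\in X$ with $0\le x$ for all $x\in X$; then $x^*:=x\to 0$ (so $0=1^*$) and the algebra is written $(X,\to,{}^*,1)$. It is involutive if $x^{**}=x$ for all $x$, and implicative if $(x\to y)\to x=x$ for all $x,y$. An implicative-ortholattice is an implicative involutive (bounded) BE algebra. Put $x\wedge_Q y:=((x^*\to y^* )\to y^* )^*$. An implicative-orthomodular lattice is an implicative-ortholattice with $x\wedge_Q(y\to x)=x$ for all $x,y$. For $a\in X$ the Sasaki projection is $\varphi_a:X\to X$, $\varphi_a x:=x\wedge_Q a$. For $x,y\in X$, $x$ commutes with $y$, written $x\,\mathcal{C}\,y$, if $\varphi_x y=(x\to y^* )^*$, i.e. $y\wedge_Q x=(x\to y^* )^*$. *)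

theory Defs
  imports Main
begin

text \<open>
  The carrier of an algebra is an arbitrary type. In a BE algebra \<open>le\<close> need be neither
  antisymmetric nor transitive, so it is not tied to the order type classes.
\<close>

locale be_algebra =
  fixes imp :: "'a \<Rightarrow> 'a \<Rightarrow> 'a"  (infixr "\<rightarrow>" 65)
    and one :: 'a  ("\<one>")
  assumes imp_self: "x \<rightarrow> x = \<one>"
    and imp_one: "x \<rightarrow> \<one> = \<one>"
    and one_imp: "\<one> \<rightarrow> x = x"
    and exchange: "x \<rightarrow> (y \<rightarrow> z) = y \<rightarrow> (x \<rightarrow> z)"
begin

definition le :: "'a \<Rightarrow> 'a \<Rightarrow> bool"  (infix "\<preceq>" 50)
  where "x \<preceq> y \<longleftrightarrow> x \<rightarrow> y = \<one>"

end

locale bounded_be_algebra = be_algebra imp one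
  for imp :: "'a \<Rightarrow> 'a \<Rightarrow> 'a"  (infixr "\<rightarrow>" 65)
    and one :: 'a  ("\<one>") +
  fixes zero :: 'a  ("\<zero>")
  assumes zero_le: "\<zero> \<preceq> x"
begin

definition neg :: "'a \<Rightarrow> 'a"  ("_\<^sup>\<star>" [1000] 999)
  where "x\<^sup>\<star> = x \<rightarrow> \<zero>"

definition meetQ :: "'a \<Rightarrow> 'a \<Rightarrow> 'a"  (infixl "\<and>\<^sub>Q" 70)
  where "x \<and>\<^sub>Q y = ((x\<^sup>\<star> \<rightarrow> y\<^sup>\<star>) \<rightarrow> y\<^sup>\<star>)\<^sup>\<star>"

text \<open>The Sasaki projection.\<close>

definition sasaki :: "'a \<Rightarrow> 'a \<Rightarrow> 'a"  ("\<phi>")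
  where "\<phi> a x = x \<and>\<^sub>Q a"

definition commutes :: "'a \<Rightarrow> 'a \<Rightarrow> bool"  (infix "\<C>" 50)
  where "x \<C> y \<longleftrightarrow> \<phi> x y = (x \<rightarrow> y\<^sup>\<star>)\<^sup>\<star>"

end

locale involutive_be_algebra = bounded_be_algebra +
  assumes neg_neg: "(x\<^sup>\<star>)\<^sup>\<star> = x"

locale implicative_ortholattice = involutive_be_algebra +
  assumes implicative: "(x \<rightarrow> y) \<rightarrow> x = x"

locale implicative_orthomodular_lattice = implicative_ortholattice +
  assumes orthomodular: "x \<and>\<^sub>Q (y \<rightarrow> x) = x"

end

theory Submission
  imports Defs
begin

text \<open>
  An implicative-ortholattice is an ortholattice in disguise: \<open>x \<squnion> y = x\<^sup>\<star> \<rightarrow> y\<close> and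
  \<open>x \<sqinter> y = (x \<rightarrow> y\<^sup>\<star>)\<^sup>\<star>\<close> are commutative and associative by contraposition and exchange,
  and absorption is exactly the implicative law. In these terms the quantum meet is the usual
  Sasaki projection, \<open>x \<and>\<^sub>Q y = (x \<squnion> y\<^sup>\<star>) \<sqinter> y\<close>, so \<open>x \<C> y\<close> says
  \<open>(y \<squnion> x\<^sup>\<star>) \<sqinter> x = x \<sqinter> y\<close>, and the defining law of an implicative-orthomodular
  lattice becomes the orthomodular law: an element \<open>a\<close> below \<open>b\<close> satisfies \<open>(a \<squnion> b\<^sup>\<star>) \<sqinter> b = a\<close>.

  If commutation is symmetric, the law is immediate: for \<open>a\<close> below \<open>b\<close> one always has
  \<open>a \<C> b\<close> (lemma \<open>commutes_if_below\<close>), and the reversed relation \<open>b \<C> a\<close> is the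
  orthomodular law for this pair. Conversely, in the presence of the law, \<open>x \<C> y\<close> yields the
  decomposition \<open>x = (x \<sqinter> y) \<squnion> (x \<sqinter> y\<^sup>\<star>)\<close> (lemma \<open>commutes_imp_decomposition\<close>).
  Substituting it into \<open>(x \<squnion> y\<^sup>\<star>) \<sqinter> y\<close>, the second summand is absorbed by \<open>y\<^sup>\<star>\<close>, and the
  orthomodular law for \<open>x \<sqinter> y\<close> below \<open>y\<close> leaves \<open>x \<sqinter> y\<close>, which is \<open>y \<C> x\<close>.
\<close>

context implicative_ortholattice
begin

definition join :: "'a \<Rightarrow> 'a \<Rightarrow> 'a"  (infixl "\<squnion>" 67)
  where "x \<squnion> y = x\<^sup>\<star> \<rightarrow> y"

definition meet :: "'a \<Rightarrow> 'a \<Rightarrow> 'a"  (infixl "\<sqinter>" 68)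
  where "x \<sqinter> y = (x \<rightarrow> y\<^sup>\<star>)\<^sup>\<star>"

text \<open>Both sides are \<open>x \<rightarrow> (y\<^sup>\<star> \<rightarrow> \<zero>)\<close>, read with the two premises in either order.\<close>

lemma contraposition: "x \<rightarrow> y = y\<^sup>\<star> \<rightarrow> x\<^sup>\<star>"
  using exchange[of x "y\<^sup>\<star>" zero] neg_neg[of y] by (simp add: neg_def)

lemma neg_join: "(x \<squnion> y)\<^sup>\<star> = x\<^sup>\<star> \<sqinter> y\<^sup>\<star>"
  by (simp add: join_def meet_def neg_neg)

lemma neg_meet: "(x \<sqinter> y)\<^sup>\<star> = x\<^sup>\<star> \<squnion> y\<^sup>\<star>"
  by (simp add: join_def meet_def neg_neg)

lemma join_commute: "x \<squnion> y = y \<squnion> x"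
  using contraposition[of "x\<^sup>\<star>" y] by (simp add: join_def neg_neg)

lemma meet_commute: "x \<sqinter> y = y \<sqinter> x"
  using join_commute by (metis neg_meet neg_neg)

lemma join_left_commute: "x \<squnion> (y \<squnion> z) = y \<squnion> (x \<squnion> z)"
  by (simp add: join_def exchange)

lemma join_assoc: "(x \<squnion> y) \<squnion> z = x \<squnion> (y \<squnion> z)"
  by (metis join_commute join_left_commute)

text \<open>After contraposition this is the implicative law for \<open>x\<close> and \<open>y\<^sup>\<star>\<close>.\<close>

lemma join_absorb: "x \<squnion> (x \<sqinter> y) = x"
  using contraposition[of "x\<^sup>\<star>" "x \<sqinter> y"] by (simp add: join_def meet_def neg_neg implicative)

lemma meet_absorb: "x \<sqinter> (x \<squnion> y) = x"
  using join_absorb[of "x\<^sup>\<star>" "y\<^sup>\<star>"] by (metis neg_join neg_meet neg_neg)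

lemma imp_eq_join: "x \<rightarrow> y = x\<^sup>\<star> \<squnion> y"
  by (simp add: join_def neg_neg)

lemma join_neg_self: "x \<squnion> x\<^sup>\<star> = \<one>"
  by (simp add: join_def imp_self)

lemma join_one: "x \<squnion> \<one> = \<one>"
  by (simp add: join_def imp_one)

lemma meet_one: "x \<sqinter> \<one> = x"
  using meet_absorb[of x \<one>] by (simp add: join_one)

lemma meetQ_eq: "x \<and>\<^sub>Q y = (x \<squnion> y\<^sup>\<star>) \<sqinter> y"
  by (simp add: meetQ_def join_def meet_def)

lemma commutes_iff: "x \<C> y \<longleftrightarrow> (y \<squnion> x\<^sup>\<star>) \<sqinter> x = x \<sqinter> y"
  by (simp add: commutes_def sasaki_def meetQ_eq) (simp add: meet_def)

text \<open>
  The order of the lattice is expressed by the equation \<open>a \<squnion> b = b\<close>. For such a pair the join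
  \<open>b \<squnion> a\<^sup>\<star>\<close> lies above \<open>a \<squnion> a\<^sup>\<star> = \<one>\<close>, so both sides of the commutation identity are \<open>a\<close>.
\<close>

lemma commutes_if_below:
  assumes "a \<squnion> b = b"
  shows "a \<C> b"
proof -
  have "b \<squnion> a\<^sup>\<star> = \<one>"
    by (metis assms join_assoc join_commute join_neg_self join_one)
  moreover have "a \<sqinter> b = a"
    by (metis assms meet_absorb)
  ultimately show ?thesis
    by (metis commutes_iff meet_commute meet_one)
qed

lemma orthomodular_if_commutes_sym:
  assumes sym: "\<And>x y. x \<C> y \<Longrightarrow> y \<C> x"
  shows "x \<and>\<^sub>Q (y \<rightarrow> x) = x"
proof -
  let ?b = "y \<rightarrow> x"
  have "?b = x \<squnion> y\<^sup>\<star>"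
    by (simp add: imp_eq_join join_commute)
  then have "x \<squnion> ?b = ?b" and meet: "x \<sqinter> ?b = x"
    by (metis join_absorb join_assoc meet_absorb, metis meet_absorb)
  then have "?b \<C> x"
    using commutes_if_below sym by blast
  then show ?thesis
    by (metis commutes_iff meet meetQ_eq meet_commute)
qed

end

context implicative_orthomodular_lattice
begin

text \<open>
  The defining law concerns pairs of the form \<open>x\<close>, \<open>y \<rightarrow> x\<close>; these are exactly the pairs
  \<open>a\<close> below \<open>b\<close>, since then \<open>b = b\<^sup>\<star> \<rightarrow> a\<close>.
\<close>

lemma orthomodular_below:
  assumes "a \<squnion> b = b"
  shows "(a \<squnion> b\<^sup>\<star>) \<sqinter> b = a"
proof -
  have "b\<^sup>\<star> \<rightarrow> a = b"
    using assms by (metis join_commute join_def)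
  then show ?thesis
    by (metis meetQ_eq orthomodular)
qed

lemma orthomodular_meet: "((x \<sqinter> y) \<squnion> x\<^sup>\<star>) \<sqinter> x = x \<sqinter> y"
  using orthomodular_below[of "x \<sqinter> y" x] by (metis join_absorb join_commute)

text \<open>
  The orthomodular law in its dual form splits \<open>x\<close> over the smaller element \<open>x \<sqinter> y\<close> as
  \<open>(x \<sqinter> y) \<squnion> (x \<sqinter> (x\<^sup>\<star> \<squnion> y\<^sup>\<star>))\<close>. The commutation identity, complemented, replaces
  \<open>x\<^sup>\<star> \<squnion> y\<^sup>\<star>\<close> by \<open>x\<^sup>\<star> \<squnion> (x \<sqinter> y\<^sup>\<star>)\<close>, whose meet with \<open>x\<close> is \<open>x \<sqinter> y\<^sup>\<star>\<close> by the same law.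
\<close>

lemma commutes_imp_decomposition:
  assumes "x \<C> y"
  shows "x = (x \<sqinter> y) \<squnion> (x \<sqinter> y\<^sup>\<star>)"
proof -
  have "(x \<sqinter> y\<^sup>\<star>) \<squnion> x\<^sup>\<star> = (x \<sqinter> y)\<^sup>\<star>"
    using assms by (metis commutes_iff join_commute meet_commute neg_join neg_meet neg_neg)
  then have rest: "(x \<sqinter> y)\<^sup>\<star> \<sqinter> x = x \<sqinter> y\<^sup>\<star>"
    by (metis orthomodular_meet)
  have "x\<^sup>\<star> \<squnion> (x \<sqinter> y)\<^sup>\<star> = (x \<sqinter> y)\<^sup>\<star>"
    by (metis neg_meet join_absorb join_commute meet_absorb join_assoc)
  then have "(x\<^sup>\<star> \<squnion> ((x \<sqinter> y)\<^sup>\<star>)\<^sup>\<star>) \<sqinter> (x \<sqinter> y)\<^sup>\<star> = x\<^sup>\<star>"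
    by (rule orthomodular_below)
  then have "(x \<sqinter> y) \<squnion> ((x \<sqinter> y)\<^sup>\<star> \<sqinter> x) = x"
    by (metis join_commute meet_commute neg_join neg_meet neg_neg)
  then show ?thesis
    by (simp add: rest)
qed

lemma commutes_sym:
  assumes "x \<C> y"
  shows "y \<C> x"
proof -
  have "x \<squnion> y\<^sup>\<star> = (x \<sqinter> y) \<squnion> ((x \<sqinter> y\<^sup>\<star>) \<squnion> y\<^sup>\<star>)"
    by (metis assms commutes_imp_decomposition join_assoc)
  also have "\<dots> = (y \<sqinter> x) \<squnion> y\<^sup>\<star>"
    by (metis join_absorb join_commute meet_commute)
  finally show ?thesis
    by (simp add: commutes_iff orthomodular_meet)
qed

end

theorem theorem4p8:
  fixes imp :: "'a \<Rightarrow> 'a \<Rightarrow> 'a" and one zero :: 'a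
  assumes "implicative_ortholattice imp one zero"
  shows "implicative_orthomodular_lattice imp one zero \<longleftrightarrow>
    (\<forall>x y. bounded_be_algebra.commutes imp zero x y \<longrightarrow>
           bounded_be_algebra.commutes imp zero y x)"
proof
  assume "implicative_orthomodular_lattice imp one zero"
  then interpret implicative_orthomodular_lattice imp one zero .
  show "\<forall>x y. bounded_be_algebra.commutes imp zero x y \<longrightarrow>
      bounded_be_algebra.commutes imp zero y x"
    using commutes_sym by blast
next
  interpret implicative_ortholattice imp one zero
    by (rule assms)
  assume "\<forall>x y. x \<C> y \<longrightarrow> y \<C> x"
  then show "implicative_orthomodular_lattice imp one zero"
    by unfold_locales (rule orthomodular_if_commutes_sym, blast)
qed

end
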